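(* Let $\mathbb{K}=\mathbb{R}$ or $\mathbb{K}=\mathbb{C}$, and let $V$ be a finite dimensional subspace of the complex vector space of functions $y\colon\mathbb{K}\to\mathbb{C}$. Then $V$ is invariant under every linear differential operator if and only if there exist $\lambda_i\in\mathbb{C}$ and positive integers $l_i$, $i=1,\dots,s$, such that $$V=\bigoplus_{i=1}^{s} H_{\lambda_i,l_i}.$$
   Context: Here $D$ is the differential operator $Dy=y'$ on functions $y\colon\mathbb{K}\to\mathbb{C}$ (derivative with respect to the variable $t\in\mathbb{K}$; real derivative if $\mathbb{K}=\mathbb{R}$, complex derivative if $\mathbb{K}=\mathbb{C}$). A linear differential operator is a polynomial evaluation $q(D)$ of $D$, with $q$ a polynomial with complex (constant) coefficients. $V$ is invariant under an operator $T$ if $T$ is defined on every element of $V$ and $T(V)\subseteq V$; in particular, invariance under $D$ includes that every element of $V$ is differentiable on $\mathbb{K}$. For an integer $m\ge 0$, $\Pi_m$ denotes the set of complex polynomials of degree at most $m$. For $\lambda\in\mathbb{C}$ and an integer $m>0$, $$H_{\lambda,m}=\{ t\mapsto e^{\lambda t}p(t) : p\in\Pi_{m-1}\},$$ a subspace of the space of functions $\mathbb{K}\to\mathbb{C}$. The symbol $\bigoplus$ denotes an internal direct sum of subspaces of the space of functions $\mathbb{K}\to\mathbb{C}$. *)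

theory Defs
  imports "HOL-Complex_Analysis.Complex_Analysis" "HOL-Library.Function_Algebras"
begin

interpretation cfun: vector_space "\<lambda>(c::complex) (f :: 'k \<Rightarrow> complex) t. c * f t"
  by unfold_locales (auto simp: fun_eq_iff algebra_simps)

text \<open>Operators need not be defined everywhere, so they are maps \<open>'f \<rightharpoonup> 'f\<close>.\<close>

definition invariant_under :: "'f set \<Rightarrow> ('f \<rightharpoonup> 'f) \<Rightarrow> bool" where
  "invariant_under V T \<longleftrightarrow> V \<subseteq> dom T \<and> (\<forall>y\<in>V. the (T y) \<in> V)"

definition D_real :: "(real \<Rightarrow> complex) \<rightharpoonup> (real \<Rightarrow> complex)" where
  "D_real y = (if \<forall>t. y differentiable (at t)
     then Some (\<lambda>t. vector_derivative y (at t)) else None)"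

definition D_complex :: "(complex \<Rightarrow> complex) \<rightharpoonup> (complex \<Rightarrow> complex)" where
  "D_complex y = (if \<forall>t. y field_differentiable (at t)
     then Some (\<lambda>t. deriv y t) else None)"

primrec op_power :: "('f \<rightharpoonup> 'f) \<Rightarrow> nat \<Rightarrow> ('f \<rightharpoonup> 'f)" where
  "op_power T 0 = Some"
| "op_power T (Suc n) = T \<circ>\<^sub>m op_power T n"

text \<open>The domains of the powers of \<open>T\<close> are decreasing, so \<open>q(T)\<close> is defined on \<open>y\<close> exactly
  when \<open>T\<close> can be applied \<open>degree q\<close> times to \<open>y\<close>.\<close>

definition poly_op :: "complex poly \<Rightarrow> (('k \<Rightarrow> complex) \<rightharpoonup> ('k \<Rightarrow> complex))
    \<Rightarrow> (('k \<Rightarrow> complex) \<rightharpoonup> ('k \<Rightarrow> complex))" where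
  "poly_op q T y = (if y \<in> dom (op_power T (degree q))
     then Some (\<lambda>t. \<Sum>i\<le>degree q. coeff q i * the (op_power T i y) t) else None)"

definition poly_deg_le :: "nat \<Rightarrow> complex poly set" where
  "poly_deg_le m = {p. degree p \<le> m}"

text \<open>The next two spaces are meant for \<open>m > 0\<close> only (subtraction on \<open>nat\<close> truncates).\<close>

definition H_real :: "complex \<Rightarrow> nat \<Rightarrow> (real \<Rightarrow> complex) set" where
  "H_real \<mu> m = {(\<lambda>t. exp (\<mu> * of_real t) * poly p (of_real t)) | p. p \<in> poly_deg_le (m - 1)}"

definition H_complex :: "complex \<Rightarrow> nat \<Rightarrow> (complex \<Rightarrow> complex) set" where
  "H_complex \<mu> m = {(\<lambda>t. exp (\<mu> * t) * poly p t) | p. p \<in> poly_deg_le (m - 1)}"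

text \<open>Internal direct sum of a finite family of subspaces: every element of \<open>V\<close> is
  \<open>\<Sum>i\<in>I. f i\<close> for a unique choice of \<open>f i \<in> W i\<close>, and all such sums are in \<open>V\<close>.
  The empty family has direct sum \<open>{0}\<close>.\<close>

definition is_direct_sum ::
    "('k \<Rightarrow> complex) set \<Rightarrow> 'i set \<Rightarrow> ('i \<Rightarrow> ('k \<Rightarrow> complex) set) \<Rightarrow> bool" where
  "is_direct_sum V I W \<longleftrightarrow> bij_betw (\<lambda>f. \<Sum>i\<in>I. f i) (\<Pi>\<^sub>E i\<in>I. W i) V"

end

theory Submission
  imports Defs "HOL-Computational_Algebra.Fundamental_Theorem_Algebra"
    "HOL-Computational_Algebra.Polynomial_Factorial" "HOL-Computational_Algebra.Field_as_Ring"
begin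

text \<open>The polynomials in \<open>D\<close> act on an invariant space \<open>V\<close>, so \<open>V\<close> is a module over
  \<open>\<complex>[X]\<close>, and the theorem is the structure of this module.

  Because \<open>V\<close> has finite dimension, \<open>y, D y, D\<^sup>2 y, \<dots>\<close> are linearly dependent for every
  \<open>y\<close>, so one nonzero polynomial \<open>q\<close> annihilates all of \<open>V\<close> (\<open>annihilator\<close>). Over \<open>\<complex>\<close> it is a
  product of powers \<open>(X - \<mu>)\<^sup>m\<close> that are pairwise coprime, and Bezout's identity splits \<open>V\<close>
  into the kernels of the operators \<open>(D - \<mu>)\<^sup>m\<close> (\<open>kernel_decomposition\<close>); the same identity
  shows that elements of these kernels are independent (\<open>kernels_independent\<close>).

  It remains to see what such a kernel is. The substitution \<open>y = exp (\<mu> t) u\<close> turns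
  \<open>(D - \<mu>)\<^sup>m y = 0\<close> into \<open>D\<^sup>m u = 0\<close>, so \<open>u\<close> is a polynomial of degree less than \<open>m\<close>
  (\<open>kernel_power_exp_poly\<close>). The kernel within \<open>V\<close> may be smaller than the full solution
  space, but it is closed under differentiating \<open>u\<close>, and a polynomial \<open>u\<close> and its derivatives
  span all polynomials of degree at most \<open>degree u\<close>. Hence the kernel is zero or exactly one of
  the spaces \<open>H \<mu> l\<close>, with \<open>l - 1\<close> the largest degree that occurs (\<open>kernel_power_eq_H\<close>).

  Conversely, each \<open>H \<mu> l\<close> is closed under \<open>D\<close>, hence so is a sum of such spaces, and closure
  under \<open>D\<close> gives closure under every polynomial in \<open>D\<close>.\<close>

section \<open>Sums of functions and complex polynomials\<close>

lemma sum_fun_apply: "(\<Sum>i\<in>I. f i) t = (\<Sum>i\<in>I. f i t)"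
  for f :: "'i \<Rightarrow> 'k \<Rightarrow> 'a::comm_monoid_add"
  by (induction I rule: infinite_finite_induct) auto

lemma pderiv_surj: "\<exists>r. pderiv r = p" for p :: "complex poly"
proof -
  define r where "r = (\<Sum>i\<le>degree p. monom (coeff p i / of_nat (Suc i)) (Suc i))"
  have "pderiv r = (\<Sum>i\<le>degree p. monom (coeff p i) i)"
    unfolding r_def higher_pderiv_sum[of 1, simplified]
    by (intro sum.cong refl) (simp add: pderiv_monom del: of_nat_Suc)
  then show ?thesis
    using poly_as_sum_of_monoms[of p] by auto
qed

lemma coprime_linear_powers:
  "\<mu> \<noteq> \<nu> \<Longrightarrow> coprime ([:-\<mu>, 1:] ^ m) ([:-\<nu>, 1:] ^ n)" for \<mu> \<nu> :: complex
proof -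
  assume "\<mu> \<noteq> \<nu>"
  have "coprime [:-\<mu>, 1:] [:-\<nu>, 1:]"
  proof (rule coprimeI)
    fix c assume "c dvd [:-\<mu>, 1:]" "c dvd [:-\<nu>, 1:]"
    then have "c dvd [:-\<mu>, 1:] - [:-\<nu>, 1:]" by (rule dvd_diff)
    then have "c dvd [:\<nu> - \<mu>:]" by simp
    moreover have "[:\<nu> - \<mu>:] dvd (1 :: complex poly)"
      using \<open>\<mu> \<noteq> \<nu>\<close> by (simp add: is_unit_const_poly_iff dvd_field_iff)
    ultimately show "is_unit c" by (rule dvd_trans)
  qed
  then show ?thesis by simp
qed

section \<open>Differentiation over the real or complex numbers\<close>

text \<open>The argument uses only the rules of differentiation below, and they hold both over \<open>\<real>\<close> and
  over \<open>\<complex>\<close>; \<open>\<iota>\<close> is the inclusion of the scalar field into \<open>\<complex>\<close>. The last assumption, that an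
  antiderivative is determined up to a constant, is where connectedness of the scalar field
  enters.\<close>

locale differentiation =
  fixes D :: "('k \<Rightarrow> complex) \<rightharpoonup> ('k \<Rightarrow> complex)" and \<iota> :: "'k \<Rightarrow> complex"
  assumes D_add: "D y = Some y' \<Longrightarrow> D z = Some z' \<Longrightarrow> D (\<lambda>t. y t + z t) = Some (\<lambda>t. y' t + z' t)"
    and D_mult: "D y = Some y' \<Longrightarrow> D z = Some z' \<Longrightarrow>
      D (\<lambda>t. y t * z t) = Some (\<lambda>t. y' t * z t + y t * z' t)"
    and D_const: "D (\<lambda>t. c) = Some (\<lambda>t. 0)"
    and D_embedding: "D \<iota> = Some (\<lambda>t. 1)"
    and D_exp: "D (\<lambda>t. exp (\<mu> * \<iota> t)) = Some (\<lambda>t. \<mu> * exp (\<mu> * \<iota> t))"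
    and D_eq_0: "D y = Some (\<lambda>t. 0) \<Longrightarrow> \<exists>c. y = (\<lambda>t. c)"
begin

text \<open>\<open>D\<close> as a total map; its values mean something on the domain of \<open>D\<close> only.\<close>

abbreviation d :: "('k \<Rightarrow> complex) \<Rightarrow> ('k \<Rightarrow> complex)" where
  "d y \<equiv> the (D y)"

definition exp_poly :: "complex \<Rightarrow> complex poly \<Rightarrow> 'k \<Rightarrow> complex" where
  "exp_poly \<mu> p = (\<lambda>t. exp (\<mu> * \<iota> t) * poly p (\<iota> t))"

definition H :: "complex \<Rightarrow> nat \<Rightarrow> ('k \<Rightarrow> complex) set" where
  "H \<mu> m = {exp_poly \<mu> p | p. p \<in> poly_deg_le (m - 1)}"

lemma D_scale: "D y = Some y' \<Longrightarrow> D (\<lambda>t. c * y t) = Some (\<lambda>t. c * y' t)"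
  using D_mult[OF D_const, of y y' c] by simp

lemma D_diff:
  assumes "D y = Some y'" "D z = Some z'"
  shows "D (\<lambda>t. y t - z t) = Some (\<lambda>t. y' t - z' t)"
  using D_add[OF assms(1) D_scale[OF assms(2), of "-1"]] by simp

lemma D_sum:
  assumes "finite I" "\<And>i. i \<in> I \<Longrightarrow> D (f i) = Some (f' i)"
  shows "D (\<Sum>i\<in>I. f i) = Some (\<Sum>i\<in>I. f' i)"
  using assms
proof (induction I rule: finite_induct)
  case empty
  then show ?case using D_const[of 0] by (simp add: zero_fun_def)
next
  case (insert i I)
  then show ?case
    using D_add[of "f i" "f' i" "\<Sum>i\<in>I. f i" "\<Sum>i\<in>I. f' i"] by (simp add: plus_fun_def)
qed

lemma D_poly: "D (\<lambda>t. poly p (\<iota> t)) = Some (\<lambda>t. poly (pderiv p) (\<iota> t))"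
proof (induction p)
  case 0
  then show ?case using D_const[of 0] by simp
next
  case (pCons a p)
  show ?case
    using D_add[OF D_const[of a] D_mult[OF D_embedding pCons.IH]]
    by (simp add: pderiv_pCons add.commute)
qed

lemma D_exp_poly: "D (exp_poly \<mu> p) = Some (exp_poly \<mu> (smult \<mu> p + pderiv p))"
  unfolding exp_poly_def using D_mult[OF D_exp[of \<mu>] D_poly[of p]]
  by (simp add: algebra_simps)

lemma exp_poly_add: "exp_poly \<mu> (p + q) = exp_poly \<mu> p + exp_poly \<mu> q"
  by (auto simp: exp_poly_def algebra_simps)

lemma exp_poly_smult: "exp_poly \<mu> (smult c p) = (\<lambda>t. c * exp_poly \<mu> p t)"
  by (auto simp: exp_poly_def)

text \<open>Variation of constants: dividing \<open>y\<close> by \<open>exp (\<mu> t)\<close> turns the operator \<open>D - \<mu>\<close> into \<open>D\<close>,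
  so that only a polynomial has to be integrated. The coefficient condition says that the degree
  is less than \<open>m\<close>, and \<open>p = 0\<close> when \<open>m = 0\<close>.\<close>

lemma first_order_solution:
  assumes y: "D y = Some y'" and eq: "\<And>t. y' t - \<mu> * y t = exp_poly \<mu> p t"
    and p: "\<forall>i\<ge>m. coeff p i = 0"
  shows "\<exists>r. (\<forall>i\<ge>Suc m. coeff r i = 0) \<and> y = exp_poly \<mu> r"
proof -
  obtain r where r: "pderiv r = p" using pderiv_surj by blast
  have "D (\<lambda>t. exp (- \<mu> * \<iota> t) * y t - poly r (\<iota> t)) =
      Some (\<lambda>t. - \<mu> * exp (- \<mu> * \<iota> t) * y t + exp (- \<mu> * \<iota> t) * y' t - poly p (\<iota> t))"
    using D_diff[OF D_mult[OF D_exp[of "-\<mu>"] y] D_poly[of r]] by (simp add: r)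
  also have "(\<lambda>t. - \<mu> * exp (- \<mu> * \<iota> t) * y t + exp (- \<mu> * \<iota> t) * y' t - poly p (\<iota> t)) = (\<lambda>t. 0)"
  proof
    fix t
    have "- \<mu> * exp (- \<mu> * \<iota> t) * y t + exp (- \<mu> * \<iota> t) * y' t =
        exp (- \<mu> * \<iota> t) * (y' t - \<mu> * y t)"
      by (simp add: algebra_simps)
    also have "\<dots> = poly p (\<iota> t)"
      by (simp add: eq exp_poly_def exp_minus)
    finally show "- \<mu> * exp (- \<mu> * \<iota> t) * y t + exp (- \<mu> * \<iota> t) * y' t - poly p (\<iota> t) = 0" by simp
  qed
  finally obtain c where c: "(\<lambda>t. exp (- \<mu> * \<iota> t) * y t - poly r (\<iota> t)) = (\<lambda>t. c)"
    using D_eq_0 by blast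
  have "y = exp_poly \<mu> (r + [:c:])"
  proof
    fix t
    have "exp (- \<mu> * \<iota> t) * y t = poly (r + [:c:]) (\<iota> t)"
      using fun_cong[OF c, of t] by (simp add: algebra_simps)
    then show "y t = exp_poly \<mu> (r + [:c:]) t"
      by (auto simp: exp_poly_def exp_minus field_simps)
  qed
  moreover have "coeff (r + [:c:]) i = 0" if "i \<ge> Suc m" for i
  proof -
    obtain j where j: "i = Suc j" "j \<ge> m" using \<open>i \<ge> Suc m\<close> by (cases i) auto
    then have "of_nat (Suc j) * coeff r (Suc j) = 0"
      using p r by (metis coeff_pderiv)
    then show ?thesis using j by (auto simp del: of_nat_Suc)
  qed
  ultimately show ?thesis by blast
qed

lemma H_closed_D:
  assumes "y \<in> H \<mu> m"
  shows "D y = Some (d y) \<and> d y \<in> H \<mu> m"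
proof -
  obtain p where p: "y = exp_poly \<mu> p" "degree p \<le> m - 1"
    using assms by (auto simp: H_def poly_deg_le_def)
  have "degree (smult \<mu> p + pderiv p) \<le> m - 1"
    using p(2) by (intro degree_add_le) (auto simp: degree_pderiv)
  then show ?thesis
    unfolding p(1) D_exp_poly by (auto simp: H_def poly_deg_le_def)
qed

section \<open>Polynomials in the differential operator\<close>

text \<open>The action of \<open>q(D)\<close>. Using the total map \<open>d\<close> frees the algebra below from domain
  conditions; on an invariant space it agrees with \<open>poly_op\<close>, see \<open>poly_op_eq_act\<close>.\<close>

definition act :: "complex poly \<Rightarrow> ('k \<Rightarrow> complex) \<Rightarrow> 'k \<Rightarrow> complex" where
  "act q y = (\<lambda>t. \<Sum>i\<le>degree q. coeff q i * (d ^^ i) y t)"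

text \<open>A common summation bound makes sums of polynomials of different degrees comparable.\<close>

lemma act_bound: "degree q \<le> n \<Longrightarrow> act q y = (\<lambda>t. \<Sum>i\<le>n. coeff q i * (d ^^ i) y t)"
  unfolding act_def by (intro ext sum.mono_neutral_left) (auto simp: coeff_eq_0)

lemma act_0 [simp]: "act 0 y = 0"
  by (auto simp: act_def)

lemma act_1 [simp]: "act 1 y = y"
  by (auto simp: act_def)

lemma act_pCons: "act (pCons a p) y = (\<lambda>t. a * y t + act p (d y) t)"
proof -
  have "act (pCons a p) y = (\<lambda>t. \<Sum>i\<le>Suc (degree p). coeff (pCons a p) i * (d ^^ i) y t)"
    by (rule act_bound) (rule degree_pCons_le)
  then show ?thesis
    by (simp add: sum.atMost_Suc_shift act_def funpow_Suc_right del: funpow.simps sum.atMost_Suc)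
qed

lemma act_add: "act (p + q) y = act p y + act q y"
proof -
  have "degree (p + q) \<le> max (degree p) (degree q)" by (rule degree_add_le_max)
  then show ?thesis
    by (simp add: act_bound[of _ "max (degree p) (degree q)"] plus_fun_def
        sum.distrib distrib_right)
qed

lemma act_smult: "act (smult c p) y = (\<lambda>t. c * act p y t)"
  by (simp add: act_bound[of _ "degree p"] sum_distrib_left mult.assoc degree_smult_le)

lemma act_linear_factor: "act [:-\<mu>, 1:] y = (\<lambda>t. d y t - \<mu> * y t)"
  by (simp add: act_pCons)

end

locale invariant_space = differentiation D \<iota>
  for D :: "('k \<Rightarrow> complex) \<rightharpoonup> ('k \<Rightarrow> complex)" and \<iota> :: "'k \<Rightarrow> complex" +
  fixes V :: "('k \<Rightarrow> complex) set"
  assumes subspace: "cfun.subspace V"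
    and D_defined: "y \<in> V \<Longrightarrow> D y = Some (d y)"
    and d_in: "y \<in> V \<Longrightarrow> d y \<in> V"
begin

lemma add_in: "y \<in> V \<Longrightarrow> z \<in> V \<Longrightarrow> y + z \<in> V"
  by (rule cfun.subspace_add[OF subspace])

lemma scale_in: "y \<in> V \<Longrightarrow> (\<lambda>t. c * y t) \<in> V"
  by (rule cfun.subspace_scale[OF subspace])

lemma diff_in: "y \<in> V \<Longrightarrow> z \<in> V \<Longrightarrow> y - z \<in> V"
  by (rule cfun.subspace_diff[OF subspace])

lemma zero_in: "0 \<in> V"
  by (rule cfun.subspace_0[OF subspace])

lemma d_add: "y \<in> V \<Longrightarrow> z \<in> V \<Longrightarrow> d (y + z) = d y + d z"
  using D_add[OF D_defined D_defined, of y z] by (simp add: plus_fun_def)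

lemma d_scale: "y \<in> V \<Longrightarrow> d (\<lambda>t. c * y t) = (\<lambda>t. c * d y t)"
  using D_scale[OF D_defined, of y c] by simp

lemma act_in: "y \<in> V \<Longrightarrow> act q y \<in> V"
proof (induction q arbitrary: y)
  case (pCons a q)
  then show ?case
    using add_in[OF scale_in[of y a] pCons.IH[OF d_in]] by (simp add: act_pCons plus_fun_def)
qed (simp add: zero_in)

lemma act_plus: "y \<in> V \<Longrightarrow> z \<in> V \<Longrightarrow> act q (y + z) = act q y + act q z"
  by (induction q arbitrary: y z)
    (simp_all add: act_pCons d_add d_in fun_eq_iff algebra_simps)

lemma act_scale: "y \<in> V \<Longrightarrow> act q (\<lambda>t. c * y t) = (\<lambda>t. c * act q y t)"
  by (induction q arbitrary: y)
    (simp_all add: act_pCons d_scale d_in fun_eq_iff algebra_simps)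

lemma act_zero [simp]: "act q 0 = 0"
  using act_scale[OF zero_in, of q 0] by (simp add: zero_fun_def)

lemma act_minus: "y \<in> V \<Longrightarrow> z \<in> V \<Longrightarrow> act q (y - z) = act q y - act q z"
  using act_plus[OF diff_in, of y z z q] by (metis add_diff_cancel_right' diff_add_cancel)

lemma act_sum: "(\<And>i. i \<in> I \<Longrightarrow> f i \<in> V) \<Longrightarrow> act q (\<Sum>i\<in>I. f i) = (\<Sum>i\<in>I. act q (f i))"
proof (induction I rule: infinite_finite_induct)
  case (insert i I)
  then have "(\<Sum>i\<in>I. f i) \<in> V" by (intro cfun.subspace_sum[OF subspace]) auto
  with insert show ?case by (simp only: sum.insert act_plus insert_iff simp_thms)
qed simp_all

text \<open>\<open>D\<close> commutes with its polynomials because it is linear on \<open>V\<close>; this is what makes \<open>act\<close>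
  multiplicative.\<close>

lemma d_act: "y \<in> V \<Longrightarrow> d (act q y) = act q (d y)"
proof (induction q arbitrary: y)
  case 0
  then show ?case using D_const[of 0] by (simp add: zero_fun_def)
next
  case (pCons a q)
  have "d (act (pCons a q) y) = d ((\<lambda>t. a * y t) + act q (d y))"
    by (simp add: act_pCons plus_fun_def)
  also have "\<dots> = (\<lambda>t. a * d y t) + act q (d (d y))"
    using pCons by (simp add: d_add scale_in act_in d_in d_scale)
  finally show ?case by (simp add: act_pCons plus_fun_def)
qed

lemma act_mult: "y \<in> V \<Longrightarrow> act (p * q) y = act p (act q y)"
proof (induction p arbitrary: y)
  case (pCons a p)
  have "act (pCons a p * q) y = (\<lambda>t. a * act q y t) + act (p * q) (d y)"
    by (simp add: act_add act_smult act_pCons plus_fun_def)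
  also have "\<dots> = (\<lambda>t. a * act q y t) + act p (d (act q y))"
    using pCons by (simp add: d_in d_act)
  finally show ?case by (simp add: act_pCons plus_fun_def)
qed simp

lemma poly_op_eq_act:
  assumes "y \<in> V"
  shows "poly_op q D y = Some (act q y)"
proof -
  have "op_power D n y = Some ((d ^^ n) y) \<and> (d ^^ n) y \<in> V" for n
  proof (induction n)
    case (Suc n)
    then obtain z where "D ((d ^^ n) y) = Some z" "z \<in> V"
      using D_defined d_in by blast
    with Suc show ?case by (simp add: map_comp_def)
  qed (simp add: assms)
  then show ?thesis by (auto simp: poly_op_def act_def)
qed

lemma invariant_poly_op: "invariant_under V (poly_op q D)"
  by (auto simp: invariant_under_def poly_op_eq_act act_in)

section \<open>Kernels of powers and the primary decomposition\<close>

text \<open>Each factor \<open>D - \<mu>\<close> costs one integration, which raises the bound on the degree by one.\<close>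

lemma kernel_power_exp_poly:
  assumes "y \<in> V" "act ([:-\<mu>, 1:] ^ m) y = 0"
  shows "\<exists>p. (\<forall>i\<ge>m. coeff p i = 0) \<and> y = exp_poly \<mu> p"
  using assms
proof (induction m arbitrary: y)
  case 0
  then show ?case by (intro exI[of _ 0]) (simp add: exp_poly_def zero_fun_def)
next
  case (Suc m)
  have "act ([:-\<mu>, 1:] ^ m) (act [:-\<mu>, 1:] y) = 0"
    using Suc.prems by (simp only: power_Suc2 act_mult)
  then obtain p where "\<forall>i\<ge>m. coeff p i = 0" "act [:-\<mu>, 1:] y = exp_poly \<mu> p"
    using Suc.IH act_in[OF Suc.prems(1)] by blast
  then show ?case
    using first_order_solution[OF D_defined[OF Suc.prems(1)]] by (metis act_linear_factor)
qed

text \<open>On the polynomial factor, \<open>D - \<mu>\<close> is plain differentiation.\<close>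

lemma act_linear_factor_exp_poly: "act [:-\<mu>, 1:] (exp_poly \<mu> p) = exp_poly \<mu> (pderiv p)"
  unfolding act_linear_factor D_exp_poly by (auto simp: exp_poly_def algebra_simps)

text \<open>The converse: each factor \<open>D - \<mu>\<close> differentiates the polynomial once.\<close>

lemma exp_poly_kernel_power:
  assumes "exp_poly \<mu> p \<in> V" "degree p < m"
  shows "act ([:-\<mu>, 1:] ^ m) (exp_poly \<mu> p) = 0"
proof -
  have "act ([:-\<mu>, 1:] ^ m) (exp_poly \<mu> p) = 0"
    if "exp_poly \<mu> p \<in> V" "\<forall>i\<ge>m. coeff p i = 0" for p
    using that
  proof (induction m arbitrary: p)
    case 0
    then have "p = 0" by (simp add: poly_eq_iff)
    then show ?case by (simp add: exp_poly_def zero_fun_def)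
  next
    case (Suc m)
    have "exp_poly \<mu> (pderiv p) \<in> V"
      using act_in[OF Suc.prems(1)] by (metis act_linear_factor_exp_poly)
    moreover have "\<forall>i\<ge>m. coeff (pderiv p) i = 0"
      using Suc.prems(2) by (simp add: coeff_pderiv)
    ultimately show ?case
      using Suc.IH Suc.prems(1) by (simp only: power_Suc2 act_mult act_linear_factor_exp_poly)
  qed
  then show ?thesis using assms by (simp add: coeff_eq_0)
qed

text \<open>The derivatives of \<open>p\<close> have every degree from \<open>degree p\<close> down to \<open>0\<close>, so they form a basis
  of the polynomials of degree at most \<open>degree p\<close>. The induction subtracts the multiple of \<open>p\<close>
  that cancels the leading term of \<open>r\<close> and continues with the derivative of \<open>p\<close>.\<close>

lemma exp_poly_lower_degree:
  assumes "exp_poly \<mu> p \<in> V" "p \<noteq> 0" "degree r \<le> degree p"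
  shows "exp_poly \<mu> r \<in> V"
  using assms
proof (induction "degree p" arbitrary: p r rule: less_induct)
  case less
  define c where "c = coeff r (degree p) / lead_coeff p"
  define r' where "r' = r - smult c p"
  have "exp_poly \<mu> r' \<in> V"
  proof (cases "degree p = 0")
    case True
    then obtain a b where "p = [:a:]" "r = [:b:]"
      using less.prems(3) by (metis degree_eq_zeroE le_zero_eq)
    then have "r' = 0" using less.prems(2) by (simp add: r'_def c_def)
    then show ?thesis using zero_in by (simp add: exp_poly_def zero_fun_def)
  next
    case False
    have "degree r' \<le> degree p"
      unfolding r'_def using less.prems degree_smult_le order_trans by (intro degree_diff_le) auto
    moreover have "coeff r' (degree p) = 0"
      using less.prems by (simp add: r'_def c_def)
    ultimately have "degree r' \<le> degree p - 1"
      using False by (metis One_nat_def Suc_pred degree_0 le_SucE leading_coeff_0_iff neq0_conv)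
    moreover have "exp_poly \<mu> (pderiv p) \<in> V"
      using act_in[OF less.prems(1)] by (metis act_linear_factor_exp_poly)
    moreover have "pderiv p \<noteq> 0" using False by (simp add: pderiv_eq_0_iff)
    ultimately show ?thesis
      using less.hyps[of "pderiv p" r'] False by (simp add: degree_pderiv)
  qed
  then have "exp_poly \<mu> (r' + smult c p) \<in> V"
    unfolding exp_poly_add exp_poly_smult using less.prems(1) by (intro add_in scale_in)
  then show ?case by (simp add: r'_def)
qed

text \<open>An element of largest degree generates the whole kernel, by the preceding lemma. A nonzero
  element is required because \<open>H \<mu> l\<close> never is the zero space.\<close>

lemma kernel_power_eq_H:
  assumes "y \<in> V" "act ([:-\<mu>, 1:] ^ m) y = 0" "y \<noteq> 0"
  shows "\<exists>l>0. H \<mu> l = {y \<in> V. act ([:-\<mu>, 1:] ^ m) y = 0}"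
proof -
  let ?K = "{y \<in> V. act ([:-\<mu>, 1:] ^ m) y = 0}"
  define P where "P = {p. exp_poly \<mu> p \<in> V \<and> p \<noteq> 0 \<and> degree p < m}"
  have K: "\<exists>p\<in>P. z = exp_poly \<mu> p" if "z \<in> ?K" "z \<noteq> 0" for z
  proof -
    obtain p where p: "\<forall>i\<ge>m. coeff p i = 0" "z = exp_poly \<mu> p"
      using kernel_power_exp_poly \<open>z \<in> ?K\<close> by blast
    then have "p \<noteq> 0" using \<open>z \<noteq> 0\<close> by (auto simp: exp_poly_def)
    moreover have "degree p < m" using p \<open>p \<noteq> 0\<close> by (meson leading_coeff_0_iff not_less)
    ultimately show ?thesis using that p by (auto simp: P_def)
  qed
  have fin: "finite (degree ` P)"
    by (rule finite_subset[of _ "{..<m}"]) (auto simp: P_def)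
  have "P \<noteq> {}" using K[of y] assms by auto
  then have "Max (degree ` P) \<in> degree ` P" by (intro Max_in fin) simp
  then obtain p where p: "p \<in> P" "Max (degree ` P) = degree p" by (rule imageE)
  have "H \<mu> (Suc (degree p)) = ?K"
  proof (intro equalityI subsetI)
    fix z assume "z \<in> H \<mu> (Suc (degree p))"
    then obtain r where r: "degree r \<le> degree p" "z = exp_poly \<mu> r"
      by (auto simp: H_def poly_deg_le_def)
    moreover have "z \<in> V"
      using exp_poly_lower_degree[of \<mu> p r] p r by (auto simp: P_def)
    ultimately show "z \<in> ?K"
      using exp_poly_kernel_power[of \<mu> r m] p by (auto simp: P_def)
  next
    fix z assume z: "z \<in> ?K"
    show "z \<in> H \<mu> (Suc (degree p))"
    proof (cases "z = 0")
      case True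
      then show ?thesis
        by (auto simp: H_def poly_deg_le_def exp_poly_def zero_fun_def intro!: exI[of _ 0])
    next
      case False
      then obtain r where r: "r \<in> P" "z = exp_poly \<mu> r" using K z by blast
      then have "degree r \<le> degree p" unfolding p(2)[symmetric] using fin by simp
      then show ?thesis using r by (auto simp: H_def poly_deg_le_def)
    qed
  qed
  then show ?thesis by blast
qed

lemma coprime_kernels_trivial:
  assumes "y \<in> V" "coprime a b" "act a y = 0" "act b y = 0"
  shows "y = 0"
proof -
  obtain u v where "u * a + v * b = 1"
    using \<open>coprime a b\<close> by (metis bezout_coefficients_fst_snd coprime_imp_gcd_eq_1)
  then have "y = act (u * a + v * b) y" by simp
  also have "\<dots> = 0" using assms by (simp add: act_add act_mult)
  finally show ?thesis .
qed

text \<open>If \<open>u a + v b = 1\<close> and \<open>a b\<close> annihilates \<open>y\<close>, then \<open>y = (u a) y + (v b) y\<close>, where the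
  first summand is annihilated by \<open>b\<close> and the second one by \<open>a\<close>. One root is split off at a
  time.\<close>

lemma kernel_decomposition:
  assumes "finite R" "y \<in> V" "act (\<Prod>\<mu>\<in>R. [:-\<mu>, 1:] ^ m \<mu>) y = 0"
  shows "\<exists>f. (\<forall>\<mu>\<in>R. f \<mu> \<in> V \<and> act ([:-\<mu>, 1:] ^ m \<mu>) (f \<mu>) = 0) \<and> y = (\<Sum>\<mu>\<in>R. f \<mu>)"
  using assms
proof (induction R arbitrary: y rule: finite_induct)
  case empty
  then show ?case by simp
next
  case (insert \<mu> R)
  define a where "a = [:-\<mu>, 1:] ^ m \<mu>"
  define b where "b = (\<Prod>\<mu>\<in>R. [:-\<mu>, 1:] ^ m \<mu>)"
  have "coprime a b"
    unfolding a_def b_def using insert.hyps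
    by (intro prod_coprime_right coprime_linear_powers[of \<mu>]) auto
  then obtain u v where uv: "u * a + v * b = 1"
    by (metis bezout_coefficients_fst_snd coprime_imp_gcd_eq_1)
  have ab: "act (a * b) y = 0"
    using insert.prems(2) by (simp only: a_def b_def prod.insert[OF insert.hyps])
  have "act b (act (u * a) y) = act u (act (a * b) y)"
    using insert.prems(1) by (simp only: act_mult[symmetric]) (simp only: mult_ac)
  then obtain f where f: "\<forall>\<mu>\<in>R. f \<mu> \<in> V \<and> act ([:-\<mu>, 1:] ^ m \<mu>) (f \<mu>) = 0"
      "act (u * a) y = (\<Sum>\<mu>\<in>R. f \<mu>)"
    using insert.IH[OF act_in[OF insert.prems(1)], of "u * a"] by (simp only: b_def[symmetric] ab act_zero) blast
  have "act a (act (v * b) y) = act v (act (a * b) y)"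
    using insert.prems(1) by (simp only: act_mult[symmetric]) (simp only: mult_ac)
  then have kern: "act a (act (v * b) y) = 0" by (simp only: ab act_zero)
  have "y = act (v * b) y + act (u * a) y"
    using act_add[of "u * a" "v * b" y] by (simp add: uv add.commute)
  moreover have "(\<Sum>\<nu>\<in>R. (f(\<mu> := act (v * b) y)) \<nu>) = (\<Sum>\<nu>\<in>R. f \<nu>)"
    using insert.hyps by (intro sum.cong) auto
  ultimately have "y = (\<Sum>\<nu>\<in>insert \<mu> R. (f(\<mu> := act (v * b) y)) \<nu>)"
    using insert.hyps f(2) by simp
  then show ?case
    using f(1) kern insert.hyps insert.prems(1)
    by (intro exI[of _ "f(\<mu> := act (v * b) y)"]) (auto simp: act_in a_def)
qed

text \<open>The product of all factors except the \<open>i\<close>-th annihilates every summand but \<open>h i\<close>, hence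
  also \<open>h i\<close>, since the sum is zero; and \<open>h i\<close> is annihilated by the \<open>i\<close>-th factor, which is coprime to that
  product.\<close>

lemma kernels_independent:
  assumes "finite I" "inj_on \<mu> I" "\<And>i. i \<in> I \<Longrightarrow> h i \<in> V"
    "\<And>i. i \<in> I \<Longrightarrow> act ([:-\<mu> i, 1:] ^ m i) (h i) = 0" "(\<Sum>i\<in>I. h i) = 0" "i \<in> I"
  shows "h i = 0"
proof -
  define b where "b = (\<Prod>j\<in>I-{i}. [:-\<mu> j, 1:] ^ m j)"
  have other: "act b (h j) = 0" if "j \<in> I - {i}" for j
  proof -
    have "b = (\<Prod>k\<in>I-{i}-{j}. [:-\<mu> k, 1:] ^ m k) * [:-\<mu> j, 1:] ^ m j"
      unfolding b_def using that assms(1) by (subst prod.remove[of _ j]) (auto simp: mult.commute)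
    then show ?thesis using that assms by (simp add: act_mult)
  qed
  have "0 = act b (\<Sum>j\<in>I. h j)" by (simp only: assms(5) act_zero)
  also have "\<dots> = (\<Sum>j\<in>I. act b (h j))" using assms(3) by (rule act_sum)
  also have "\<dots> = act b (h i)"
    using assms other by (subst sum.remove[of _ i]) auto
  finally have "act b (h i) = 0" by simp
  moreover have "coprime b ([:-\<mu> i, 1:] ^ m i)"
    unfolding b_def using assms by (intro prod_coprime_left coprime_linear_powers) (auto dest: inj_onD)
  ultimately show ?thesis
    using coprime_kernels_trivial assms by blast
qed

section \<open>Finite dimension\<close>

text \<open>The \<open>card B + 1\<close> vectors \<open>y, D y, \<dots>, D\<^sup>n y\<close> with \<open>n = card B\<close> cannot be independent. Dependence
  is a property of a set of vectors, so a repetition among them is treated separately: it gives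
  the polynomial \<open>X\<^sup>i - X\<^sup>j\<close>.\<close>

lemma vector_annihilator:
  assumes "finite B" "V = cfun.span B" "y \<in> V"
  shows "\<exists>q. q \<noteq> 0 \<and> act q y = 0"
proof (cases "inj_on (\<lambda>i. (d ^^ i) y) {..card B}")
  case False
  then obtain i j where ij: "i \<noteq> j" "(d ^^ i) y = (d ^^ j) y" by (auto simp: inj_on_def)
  have monom: "act (monom c k) y = (\<lambda>t. c * (d ^^ k) y t)" for c k
    by (subst act_bound[OF degree_monom_le]) (auto simp: sum.remove[of _ k] intro!: sum.neutral)
  have "act (monom 1 i + monom (-1) j) y = 0"
    by (simp add: act_add monom ij fun_eq_iff)
  moreover have "coeff (monom 1 i + monom (-1) j :: complex poly) i \<noteq> 0" using ij by simp
  then have "monom 1 i + monom (-1) j \<noteq> (0 :: complex poly)" by (metis coeff_0)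
  ultimately show ?thesis by blast
next
  case inj: True
  let ?S = "(\<lambda>i. (d ^^ i) y) ` {..card B}"
  have "(d ^^ i) y \<in> V" for i by (induction i) (auto simp: assms(3) d_in)
  then have "?S \<subseteq> cfun.span B" using assms(2) by auto
  moreover have "card ?S = Suc (card B)" using inj by (simp add: card_image)
  ultimately have "cfun.dependent ?S"
    using cfun.independent_span_bound[OF assms(1), of ?S] by auto
  then obtain u v where u: "v \<in> ?S" "u v \<noteq> 0" "(\<Sum>v\<in>?S. (\<lambda>t. u v * v t)) = 0"
    using cfun.dependent_finite[of ?S] by auto
  define q where "q = (\<Sum>i\<le>card B. monom (u ((d ^^ i) y)) i)"
  have coeff: "coeff q i = (if i \<le> card B then u ((d ^^ i) y) else 0)" for i
    by (auto simp: q_def coeff_sum)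
  then have "degree q \<le> card B" by (intro degree_le) simp
  then have "act q y = (\<Sum>i\<le>card B. (\<lambda>t. u ((d ^^ i) y) * (d ^^ i) y t))"
    by (auto simp: act_bound coeff sum_fun_apply)
  also have "\<dots> = 0" using u(3) by (simp add: sum.reindex[OF inj])
  finally have "act q y = 0" .
  moreover from u(1) obtain i where "i \<le> card B" "v = (d ^^ i) y" by auto
  then have "coeff q i \<noteq> 0" using coeff u(2) by simp
  then have "q \<noteq> 0" by auto
  ultimately show ?thesis by blast
qed

text \<open>The product of annihilators of the elements of \<open>B\<close> annihilates their span.\<close>

lemma annihilator:
  assumes "finite B" "V = cfun.span B"
  shows "\<exists>q. q \<noteq> 0 \<and> (\<forall>y\<in>V. act q y = 0)"
proof -
  have B: "b \<in> V" if "b \<in> B" for b using assms(2) that by (simp add: cfun.span_base)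
  have "\<forall>b\<in>B. \<exists>q. q \<noteq> 0 \<and> act q b = 0" using vector_annihilator[OF assms] B by blast
  then obtain q where q: "\<And>b. b \<in> B \<Longrightarrow> q b \<noteq> 0 \<and> act (q b) b = 0" by metis
  have Q: "act (\<Prod>b\<in>B. q b) b = 0" if "b \<in> B" for b
  proof -
    have "(\<Prod>b\<in>B. q b) = (\<Prod>b\<in>B-{b}. q b) * q b"
      using that assms(1) by (subst prod.remove[of _ b]) (auto simp: mult.commute)
    then show ?thesis using that B q by (simp add: act_mult)
  qed
  have "act (\<Prod>b\<in>B. q b) y = 0" if "y \<in> V" for y
  proof -
    have "y \<in> cfun.span B" using that assms(2) by simp
    then have "y \<in> V \<and> act (\<Prod>b\<in>B. q b) y = 0"
    proof (rule cfun.span_induct)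
      show "cfun.subspace {y. y \<in> V \<and> act (\<Prod>b\<in>B. q b) y = 0}"
        by (rule cfun.subspaceI)
          (auto simp: zero_in add_in scale_in act_plus act_scale)
    qed (use B Q in auto)
    then show ?thesis by simp
  qed
  moreover have "(\<Prod>b\<in>B. q b) \<noteq> 0" using q assms(1) by simp
  ultimately show ?thesis by blast
qed

lemma H_decomposition:
  assumes "finite B" "V = cfun.span B"
  shows "\<exists>(s::nat) \<mu> l. (\<forall>i\<in>{1..s}. l i > 0) \<and> is_direct_sum V {1..s} (\<lambda>i. H (\<mu> i) (l i))"
proof -
  obtain q where q: "q \<noteq> 0" "\<And>y. y \<in> V \<Longrightarrow> act q y = 0" using annihilator[OF assms] by blast
  define m where "m = (\<lambda>\<mu>. order \<mu> q)"
  define K where "K \<mu> = {y \<in> V. act ([:-\<mu>, 1:] ^ m \<mu>) y = 0}" for \<mu>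
  define R where "R = {\<mu>. poly q \<mu> = 0}"
  \<comment> \<open>Roots with trivial kernel contribute nothing to the sum and are left out of \<open>R'\<close>, since the
    zero space is not of the form \<open>H \<mu> l\<close>.\<close>
  define R' where "R' = {\<mu> \<in> R. \<exists>y\<in>K \<mu>. y \<noteq> 0}"
  have fin: "finite R" using q poly_roots_finite by (simp add: R_def)
  have "act (\<Prod>\<mu>\<in>R. [:-\<mu>, 1:] ^ m \<mu>) y = 0" if "y \<in> V" for y
  proof -
    have "smult (lead_coeff q) (\<Prod>\<mu>\<in>R. [:-\<mu>, 1:] ^ m \<mu>) = q"
      unfolding R_def m_def by (rule complex_poly_decompose)
    then have "(\<lambda>t. lead_coeff q * act (\<Prod>\<mu>\<in>R. [:-\<mu>, 1:] ^ m \<mu>) y t) = act q y"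
      using act_smult[of "lead_coeff q" "\<Prod>\<mu>\<in>R. [:-\<mu>, 1:] ^ m \<mu>" y] by (simp only:)
    also have "act q y = 0" using q(2) that .
    finally have "lead_coeff q * act (\<Prod>\<mu>\<in>R. [:-\<mu>, 1:] ^ m \<mu>) y t = 0" for t
      by (drule_tac x = t in fun_cong) simp
    then show ?thesis using q(1) by (simp add: fun_eq_iff)
  qed
  then have decomp: "\<exists>f. (\<forall>\<mu>\<in>R. f \<mu> \<in> K \<mu>) \<and> y = (\<Sum>\<mu>\<in>R. f \<mu>)" if "y \<in> V" for y
    using kernel_decomposition[OF fin that, of m] that by (auto simp: K_def)
  have "\<forall>\<mu>\<in>R'. \<exists>l>0. H \<mu> l = K \<mu>"
    unfolding R'_def using kernel_power_eq_H by (auto simp: K_def)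
  then obtain l where l: "\<And>\<mu>. \<mu> \<in> R' \<Longrightarrow> l \<mu> > 0 \<and> H \<mu> (l \<mu>) = K \<mu>" by metis
  have "finite R'" using fin by (simp add: R'_def)
  then obtain \<mu> where \<mu>: "bij_betw \<mu> {1..card R'} R'"
    using ex_bij_betw_nat_finite_1 by blast
  let ?I = "{1..card R'}"
  have \<mu>R: "\<mu> i \<in> R'" if "i \<in> ?I" for i using \<mu> that by (auto simp: bij_betw_def)
  have "is_direct_sum V ?I (\<lambda>i. K (\<mu> i))"
    unfolding is_direct_sum_def bij_betw_def
  proof (intro conjI equalityI subsetI)
    show "inj_on (\<lambda>f. \<Sum>i\<in>?I. f i) (\<Pi>\<^sub>E i\<in>?I. K (\<mu> i))"
    proof (rule inj_onI)
      fix f g assume fg: "f \<in> (\<Pi>\<^sub>E i\<in>?I. K (\<mu> i))" "g \<in> (\<Pi>\<^sub>E i\<in>?I. K (\<mu> i))"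
        and eq: "(\<Sum>i\<in>?I. f i) = (\<Sum>i\<in>?I. g i)"
      have mem: "f i \<in> K (\<mu> i)" "g i \<in> K (\<mu> i)" if "i \<in> ?I" for i
        using PiE_mem[OF fg(1) that] PiE_mem[OF fg(2) that] by auto
      have "f i - g i \<in> K (\<mu> i)" if "i \<in> ?I" for i
        using mem[OF that] by (simp add: K_def diff_in act_minus)
      moreover have "(\<Sum>i\<in>?I. f i - g i) = 0" using eq by (simp add: sum_subtractf)
      ultimately have "f i - g i = 0" if "i \<in> ?I" for i
        using kernels_independent[of ?I \<mu> "\<lambda>i. f i - g i" "\<lambda>i. m (\<mu> i)" i] \<mu> that
        by (auto simp: K_def bij_betw_def)
      then show "f = g"
        using fg by (intro PiE_ext) auto
    qed
  next
    fix y assume "y \<in> (\<lambda>f. \<Sum>i\<in>?I. f i) ` (\<Pi>\<^sub>E i\<in>?I. K (\<mu> i))"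
    then obtain f where "f \<in> (\<Pi>\<^sub>E i\<in>?I. K (\<mu> i))" "y = (\<Sum>i\<in>?I. f i)" by blast
    then show "y \<in> V"
      using PiE_mem[of f ?I] by (auto simp: K_def intro!: cfun.subspace_sum[OF subspace])
  next
    fix y assume "y \<in> V"
    then obtain f where f: "\<forall>\<mu>\<in>R. f \<mu> \<in> K \<mu>" "y = (\<Sum>\<mu>\<in>R. f \<mu>)" using decomp by blast
    have "(\<Sum>\<mu>\<in>R. f \<mu>) = (\<Sum>\<mu>\<in>R'. f \<mu>)"
      using fin f(1) by (intro sum.mono_neutral_right) (auto simp: R'_def)
    also have "\<dots> = (\<Sum>i\<in>?I. f (\<mu> i))"
      using sum.reindex_bij_betw[OF \<mu>, of f] by simp
    finally have "y = (\<Sum>i\<in>?I. restrict (\<lambda>i. f (\<mu> i)) ?I i)" by (simp add: f(2))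
    moreover have "restrict (\<lambda>i. f (\<mu> i)) ?I \<in> (\<Pi>\<^sub>E i\<in>?I. K (\<mu> i))"
      using f(1) \<mu>R by (auto simp: R'_def)
    ultimately show "y \<in> (\<lambda>f. \<Sum>i\<in>?I. f i) ` (\<Pi>\<^sub>E i\<in>?I. K (\<mu> i))" by blast
  qed
  moreover have "(\<Pi>\<^sub>E i\<in>?I. K (\<mu> i)) = (\<Pi>\<^sub>E i\<in>?I. H (\<mu> i) (l (\<mu> i)))"
    using l \<mu>R by (intro PiE_cong) auto
  ultimately have "is_direct_sum V ?I (\<lambda>i. H (\<mu> i) (l (\<mu> i)))"
    by (simp add: is_direct_sum_def)
  moreover have "\<forall>i\<in>?I. l (\<mu> i) > 0" using l \<mu>R by auto
  ultimately show ?thesis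
    by (intro exI[of _ "card R'"] exI[of _ \<mu>] exI[of _ "\<lambda>i. l (\<mu> i)"] conjI)
qed

end

section \<open>The characterisation\<close>

context differentiation
begin

lemma H_sum_closed_D:
  assumes "is_direct_sum V I (\<lambda>i. H (\<mu> i) (l i))" "finite I" "y \<in> V"
  shows "D y = Some (d y) \<and> d y \<in> V"
proof -
  have V: "V = (\<lambda>f. \<Sum>i\<in>I. f i) ` (\<Pi>\<^sub>E i\<in>I. H (\<mu> i) (l i))"
    using assms(1) by (simp add: is_direct_sum_def bij_betw_def)
  then obtain f where f: "f \<in> (\<Pi>\<^sub>E i\<in>I. H (\<mu> i) (l i))" "y = (\<Sum>i\<in>I. f i)"
    using assms(3) by blast
  have fi: "D (f i) = Some (d (f i)) \<and> d (f i) \<in> H (\<mu> i) (l i)" if "i \<in> I" for i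
    using H_closed_D PiE_mem[OF f(1) that] by blast
  have Dy: "D y = Some (\<Sum>i\<in>I. d (f i))"
    unfolding f(2) using assms(2) fi by (intro D_sum) auto
  have "restrict (\<lambda>i. d (f i)) I \<in> (\<Pi>\<^sub>E i\<in>I. H (\<mu> i) (l i))" using fi by auto
  then have "(\<Sum>i\<in>I. restrict (\<lambda>i. d (f i)) I i) \<in> V" unfolding V by (rule imageI)
  then show ?thesis using Dy by simp
qed

text \<open>Invariance under the polynomial \<open>X\<close> is invariance under \<open>D\<close> itself, with differentiability
  coming from the domain of \<open>poly_op\<close>.\<close>

lemma invariant_X:
  assumes "invariant_under V (poly_op [:0, 1:] D)" "y \<in> V"
  shows "D y = Some (d y) \<and> d y \<in> V"
proof -
  from assms have "y \<in> dom (poly_op [:0, 1:] D)" "the (poly_op [:0, 1:] D y) \<in> V"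
    by (auto simp: invariant_under_def)
  then show ?thesis
    by (auto simp: poly_op_def map_comp_def split: if_splits)
qed

theorem invariant_iff_direct_sum:
  assumes "cfun.subspace V" "finite B" "V = cfun.span B"
  shows "(\<forall>q. invariant_under V (poly_op q D)) \<longleftrightarrow>
    (\<exists>(s::nat) \<mu> l. (\<forall>i\<in>{1..s}. l i > 0) \<and> is_direct_sum V {1..s} (\<lambda>i. H (\<mu> i) (l i)))"
proof
  assume "\<forall>q. invariant_under V (poly_op q D)"
  then interpret invariant_space D \<iota> V
    using invariant_X assms(1) by unfold_locales auto
  show "\<exists>(s::nat) \<mu> l. (\<forall>i\<in>{1..s}. l i > 0) \<and> is_direct_sum V {1..s} (\<lambda>i. H (\<mu> i) (l i))"
    using H_decomposition assms(2,3) by blast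
next
  assume "\<exists>(s::nat) \<mu> l. (\<forall>i\<in>{1..s}. l i > 0) \<and> is_direct_sum V {1..s} (\<lambda>i. H (\<mu> i) (l i))"
  then obtain s :: nat and \<mu> l where "is_direct_sum V {1..s} (\<lambda>i. H (\<mu> i) (l i))" by blast
  then interpret invariant_space D \<iota> V
    using H_sum_closed_D[of V "{1..s}"] assms(1) by unfold_locales auto
  show "\<forall>q. invariant_under V (poly_op q D)" using invariant_poly_op by blast
qed

end

lemma D_real_eq_Some: "D_real y = Some y' \<longleftrightarrow> (\<forall>t. (y has_vector_derivative y' t) (at t))"
proof
  assume "D_real y = Some y'"
  then have "\<forall>t. y differentiable (at t)" "y' = (\<lambda>t. vector_derivative y (at t))"
    by (simp_all add: D_real_def split: if_splits)
  then show "\<forall>t. (y has_vector_derivative y' t) (at t)"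
    by (simp add: vector_derivative_works)
next
  assume *: "\<forall>t. (y has_vector_derivative y' t) (at t)"
  then have "\<forall>t. y differentiable (at t)" by (blast intro: differentiableI_vector)
  moreover have "(\<lambda>t. vector_derivative y (at t)) = y'"
    using * by (intro ext vector_derivative_at) simp
  ultimately show "D_real y = Some y'" by (simp add: D_real_def)
qed

lemma D_complex_eq_Some: "D_complex y = Some y' \<longleftrightarrow> (\<forall>t. (y has_field_derivative y' t) (at t))"
proof
  assume "D_complex y = Some y'"
  then have "\<forall>t. y field_differentiable (at t)" "y' = (\<lambda>t. deriv y t)"
    by (simp_all add: D_complex_def split: if_splits)
  then show "\<forall>t. (y has_field_derivative y' t) (at t)"
    by (simp add: DERIV_deriv_iff_field_differentiable)
next
  assume *: "\<forall>t. (y has_field_derivative y' t) (at t)"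
  then have "\<forall>t. y field_differentiable (at t)" by (auto simp: field_differentiable_def)
  moreover have "(\<lambda>t. deriv y t) = y'"
    using * by (intro ext DERIV_imp_deriv) simp
  ultimately show "D_complex y = Some y'" by (simp add: D_complex_def)
qed

interpretation real: differentiation D_real of_real
proof
  fix y z y' z' :: "real \<Rightarrow> complex"
  assume "D_real y = Some y'" "D_real z = Some z'"
  then show "D_real (\<lambda>t. y t + z t) = Some (\<lambda>t. y' t + z' t)"
    and "D_real (\<lambda>t. y t * z t) = Some (\<lambda>t. y' t * z t + y t * z' t)"
    unfolding D_real_eq_Some by (auto intro!: derivative_eq_intros)
next
  fix c
  show "D_real (\<lambda>t. c) = Some (\<lambda>t. 0)"
    unfolding D_real_eq_Some by simp
next
  show "D_real of_real = Some (\<lambda>t. 1)"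
    unfolding D_real_eq_Some by (auto intro!: derivative_eq_intros)
next
  fix \<mu>
  have "((\<lambda>t. exp (\<mu> * complex_of_real t)) has_vector_derivative \<mu> * exp (\<mu> * of_real t)) (at t)" for t
    by (rule has_vector_derivative_real_field[of "\<lambda>z. exp (\<mu> * z)"])
      (auto intro!: derivative_eq_intros)
  then show "D_real (\<lambda>t. exp (\<mu> * complex_of_real t)) = Some (\<lambda>t. \<mu> * exp (\<mu> * of_real t))"
    unfolding D_real_eq_Some by blast
next
  fix y assume "D_real y = Some (\<lambda>t. 0)"
  then show "\<exists>c. y = (\<lambda>t. c)"
    unfolding D_real_eq_Some
    using has_vector_derivative_zero_constant[of UNIV y] by (metis UNIV_I convex_UNIV ext)
qed

interpretation complex: differentiation D_complex "\<lambda>t. t"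
proof
  fix y z y' z' :: "complex \<Rightarrow> complex"
  assume "D_complex y = Some y'" "D_complex z = Some z'"
  then show "D_complex (\<lambda>t. y t + z t) = Some (\<lambda>t. y' t + z' t)"
    and "D_complex (\<lambda>t. y t * z t) = Some (\<lambda>t. y' t * z t + y t * z' t)"
    unfolding D_complex_eq_Some by (auto intro!: derivative_eq_intros)
next
  fix c
  show "D_complex (\<lambda>t. c) = Some (\<lambda>t. 0)"
    unfolding D_complex_eq_Some by simp
next
  show "D_complex (\<lambda>t. t) = Some (\<lambda>t. 1)"
    unfolding D_complex_eq_Some by (auto intro!: derivative_eq_intros)
next
  fix \<mu>
  show "D_complex (\<lambda>t. exp (\<mu> * t)) = Some (\<lambda>t. \<mu> * exp (\<mu> * t))"
    unfolding D_complex_eq_Some by (auto intro!: derivative_eq_intros)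
next
  fix y assume "D_complex y = Some (\<lambda>t. 0)"
  then show "\<exists>c. y = (\<lambda>t. c)"
    unfolding D_complex_eq_Some
    using has_field_derivative_zero_constant[of UNIV y] by (metis UNIV_I convex_UNIV ext)
qed

lemma H_real_eq: "H_real = real.H"
  by (intro ext) (simp add: H_real_def real.H_def real.exp_poly_def)

lemma H_complex_eq: "H_complex = complex.H"
  by (intro ext) (simp add: H_complex_def complex.H_def complex.exp_poly_def)

theorem theorem5:
  shows "(\<forall>V :: (real \<Rightarrow> complex) set.
            cfun.subspace V \<and> (\<exists>B. finite B \<and> V = cfun.span B) \<longrightarrow>
              ((\<forall>q. invariant_under V (poly_op q D_real)) \<longleftrightarrow>
               (\<exists>(s::nat) (\<mu> :: nat \<Rightarrow> complex) (l :: nat \<Rightarrow> nat).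
                  (\<forall>i\<in>{1..s}. l i > 0) \<and>
                  is_direct_sum V {1..s} (\<lambda>i. H_real (\<mu> i) (l i)))))
       \<and> (\<forall>V :: (complex \<Rightarrow> complex) set.
            cfun.subspace V \<and> (\<exists>B. finite B \<and> V = cfun.span B) \<longrightarrow>
              ((\<forall>q. invariant_under V (poly_op q D_complex)) \<longleftrightarrow>
               (\<exists>(s::nat) (\<mu> :: nat \<Rightarrow> complex) (l :: nat \<Rightarrow> nat).
                  (\<forall>i\<in>{1..s}. l i > 0) \<and>
                  is_direct_sum V {1..s} (\<lambda>i. H_complex (\<mu> i) (l i)))))"
  unfolding H_real_eq H_complex_eq
  by (intro conjI allI impI; elim conjE exE)
    (rule real.invariant_iff_direct_sum complex.invariant_iff_direct_sum; assumption)+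

end
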